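(* Let $\mathrm{CNOT1}=|0000\rangle+|0110\rangle+|1011\rangle+|1101\rangle$, $\mathrm{CNOT2}=|0000\rangle+|0111\rangle+|1001\rangle+|1110\rangle$ (4-arity gates) and let $\mathrm{EQ}=\langle00|+\langle11|$ (the 2-arity EQUAL cogate). There do not exist invertible matrices $A,B,C,D,E,F,G,H,I,J,K,L\in\mathbb{C}^{2\times2}$ such that the chain CNOT1-CNOT2-CNOT1 linked by EQUAL cogates is Pfaffian, i.e. such that all of the following hold simultaneously: - CNOT1 is Pfaffian under $A\otimes B\otimes C\otimes D$; - CNOT2 is Pfaffian under $E\otimes F\otimes G\otimes H$; - CNOT1 is Pfaffian under $I\otimes J\otimes K\otimes L$; - EQ is Pfaffian under each of $D^{-1}\otimes E^{-1}$, $C^{-1}\otimes F^{-1}$, $H^{-1}\otimes I^{-1}$ and $G^{-1}\otimes J^{-1}$.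
   Context: Let $V=\mathbb{C}^2$ with basis $|0\rangle,|1\rangle$ and dual basis $\langle0|,\langle1|$. An $n$-arity gate is an element of $V^{\otimes n}$, and an $n$-arity cogate is an element of $(V^* )^{\otimes n}$. For $S\subseteq[n]=\{1,\dots,n\}$, $|S\rangle$ and $\langle S|$ denote the basis ket and bra whose bitstring is the indicator of $S$, and $S^c=[n]\setminus S$. Rows and columns of $2\times2$ matrices are indexed by $0,1$. A matrix $M$ acts on kets by $M|j\rangle=M_{0j}|0\rangle+M_{1j}|1\rangle$ and on bras by $M\langle j|=M_{j0}\langle0|+M_{j1}\langle1|$ (row-vector multiplication). For an $n\times n$ complex skew-symmetric matrix $\Xi$ put $\mathrm{sPf}(\Xi)=\sum_{S\subseteq[n]}\mathrm{Pf}(\Xi|_S)|S\rangle$ and $\mathrm{sPf}^*(\Xi)=\sum_{S\subseteq[n]}\mathrm{Pf}(\Xi|_{S^c})\langle S|$, where $\Xi|_S$ is the submatrix with rows and columns in $S$, and the Pfaffian $\mathrm{Pf}$ is $1$ for the empty matrix and $0$ for odd size. An $n$-arity gate $T$ is Pfaffian under $M_1\otimes\cdots\otimes M_n$ if $(M_1\otimes\cdots\otimes M_n)T=\alpha\,\mathrm{sPf}(\Xi)$ for some $\alpha\in\mathbb{C}$ and skew-symmetric $\Xi\in\mathbb{C}^{n\times n}$. An $n$-arity cogate $T$ is Pfaffian under $M_1^{-1}\otimes\cdots\otimes M_n^{-1}$ if $(M_1^{-1}\otimes\cdots\otimes M_n^{-1})T=\beta\,\mathrm{sPf}^*(\Theta)$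 for some $\beta\in\mathbb{C}$ and skew-symmetric $\Theta\in\mathbb{C}^{n\times n}$. The four tensor factors of a CNOT gate correspond to its wires $1,2,3,4$ around the vertex: wires 1, 2 are inputs, wire 4 is the output of wire 1 and wire 3 is the output of wire 2; consecutive gates are linked by connecting wires 4 and 3 of one gate to wires 1 and 2 of the next, respectively, through EQUAL cogates. An edge with change of basis $M$ applies $M$ on the gate side and $M^{-1}$ on the cogate side. *)

theory Defs
  imports
    "HOL-Combinatorics.Permutations"
    "Jordan_Normal_Form.Gauss_Jordan_Elimination"
    "Jordan_Normal_Form.DL_Submatrix"
begin

(* Gates are represented by their coordinates in the ket basis and cogates by their coordinates
   in the bra basis, indexed by bitstrings (lists over {0, 1}). The arity n is carried by the
   length of the bitstrings, and coordinates at all other lists are 0. Wires and matrix indices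
   are numbered from 0, so wire i of the usual numbering 1, ..., n is list position i - 1. *)

type_synonym gate = "nat list \<Rightarrow> complex"
type_synonym cogate = "nat list \<Rightarrow> complex"

definition bitstrings :: "nat \<Rightarrow> nat list set" where
  "bitstrings n = {b. length b = n \<and> set b \<subseteq> {0, 1}}"

definition ket :: "nat list \<Rightarrow> gate" where
  "ket c = (\<lambda>b. if b = c then 1 else 0)"

definition bra :: "nat list \<Rightarrow> cogate" where
  "bra c = (\<lambda>b. if b = c then 1 else 0)"

definition indicator_bits :: "nat \<Rightarrow> nat set \<Rightarrow> nat list" where
  "indicator_bits n S = map (\<lambda>i. if i \<in> S then 1 else 0) [0..<n]"

(* The linear extension of  M |j> = M_{0j} |0> + M_{1j} |1>  in each tensor factor. *)
definition act_gate :: "complex mat list \<Rightarrow> gate \<Rightarrow> gate" where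
  "act_gate Ms T = (\<lambda>b. if b \<in> bitstrings (length Ms)
     then \<Sum>c \<in> bitstrings (length Ms). (\<Prod>i<length Ms. Ms ! i $$ (b ! i, c ! i)) * T c
     else 0)"

(* The linear extension of  M <j| = M_{j0} <0| + M_{j1} <1|  in each tensor factor;
   compared with act_gate, the row and column indices are exchanged. *)
definition act_cogate :: "complex mat list \<Rightarrow> cogate \<Rightarrow> cogate" where
  "act_cogate Ms T = (\<lambda>b. if b \<in> bitstrings (length Ms)
     then \<Sum>c \<in> bitstrings (length Ms). (\<Prod>i<length Ms. Ms ! i $$ (c ! i, b ! i)) * T c
     else 0)"

definition skew_symmetric :: "complex mat \<Rightarrow> bool" where
  "skew_symmetric A \<longleftrightarrow> square_mat A \<and> transpose_mat A = - A"

(* For n = 2 k:  Pf A = 1 / (2^k k!) * (sum over all permutations p of {0, ..., n - 1} of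
   sign p * A_{p 0, p 1} * A_{p 2, p 3} * ... * A_{p (n - 2), p (n - 1)}). *)
definition pfaffian :: "complex mat \<Rightarrow> complex" where
  "pfaffian A = (let n = dim_row A; k = n div 2 in
     if even n
     then (\<Sum>p | p permutes {..<n}. of_int (sign p) * (\<Prod>i<k. A $$ (p (2 * i), p (2 * i + 1))))
            / (2 ^ k * fact k)
     else 0)"

definition sPf :: "complex mat \<Rightarrow> gate" where
  "sPf \<Xi> = (let n = dim_row \<Xi> in
     (\<lambda>b. \<Sum>S \<in> Pow {..<n}. pfaffian (submatrix \<Xi> S S) * ket (indicator_bits n S) b))"

definition sPf_star :: "complex mat \<Rightarrow> cogate" where
  "sPf_star \<Theta> = (let n = dim_row \<Theta> in
     (\<lambda>b. \<Sum>S \<in> Pow {..<n}.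
       pfaffian (submatrix \<Theta> ({..<n} - S) ({..<n} - S)) * bra (indicator_bits n S) b))"

(* Ms lists the matrices M_1, ..., M_n; its length is the arity. *)
definition pfaffian_gate_under :: "gate \<Rightarrow> complex mat list \<Rightarrow> bool" where
  "pfaffian_gate_under T Ms \<longleftrightarrow>
     (\<exists>\<alpha> \<Xi>. \<Xi> \<in> carrier_mat (length Ms) (length Ms) \<and> skew_symmetric \<Xi> \<and>
        act_gate Ms T = (\<lambda>b. \<alpha> * sPf \<Xi> b))"

(* Here Ms lists the matrices that act on the bras, i.e. the inverses M_1^{-1}, ..., M_n^{-1}
   of the matrices that act on the gate side of the edges. *)
definition pfaffian_cogate_under :: "cogate \<Rightarrow> complex mat list \<Rightarrow> bool" where
  "pfaffian_cogate_under T Ms \<longleftrightarrow>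
     (\<exists>\<beta> \<Theta>. \<Theta> \<in> carrier_mat (length Ms) (length Ms) \<and> skew_symmetric \<Theta> \<and>
        act_cogate Ms T = (\<lambda>b. \<beta> * sPf_star \<Theta> b))"

(* Meaningful only for invertible matrices. *)
definition mat_inv :: "complex mat \<Rightarrow> complex mat" where
  "mat_inv M = the (mat_inverse M)"

definition CNOT1 :: gate where
  "CNOT1 = (\<lambda>b. ket [0,0,0,0] b + ket [0,1,1,0] b + ket [1,0,1,1] b + ket [1,1,0,1] b)"

definition CNOT2 :: gate where
  "CNOT2 = (\<lambda>b. ket [0,0,0,0] b + ket [0,1,1,1] b + ket [1,0,0,1] b + ket [1,1,1,0] b)"

definition EQ :: cogate where
  "EQ = (\<lambda>b. bra [0,0] b + bra [1,1] b)"

end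

theory Submission
  imports Defs
begin

text \<open>
  Put \<open>Z = diag (1, -1)\<close>, \<open>X\<close> for the bit flip, \<open>Y\<close> for the third Pauli matrix, and
  \<open>P\<^sub>M = M\<inverse> Z M\<close> for the reflection that a change of basis \<open>M\<close> attaches to its wire. Pfaffians of
  odd size vanish, so a Pfaffian gate in its new basis is fixed by \<open>Z \<otimes> Z \<otimes> Z \<otimes> Z\<close>; in the old basis
  it is fixed by the product of the reflections \<open>P\<^sub>M\<close> of its wires. In the same way an EQUAL
  cogate on the edge between \<open>C\<close> and \<open>F\<close> forces \<open>P\<^sub>F\<close> to be the transpose of \<open>P\<^sub>C\<close>.

  A CNOT gate copies its control wires in the eigenbasis of \<open>Z\<close> and its target wires in the
  eigenbasis of \<open>X\<close>. Its stabilisers of the above form are of two kinds. Either the reflections of the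
  control wires are \<open>\<plusminus>Z\<close> and those of the target wires are \<open>\<plusminus>X\<close>; this is incompatible with the
  empty Pfaffian being nonzero and the quadratic relation that expands a \<open>4 \<times> 4\<close> Pfaffian. Or the
  reflections of the control wires anticommute with \<open>Z\<close>, those of the target wires anticommute with
  \<open>X\<close>, and the upper right entries \<open>p, q\<close> of the two control reflections satisfy \<open>(p q)\<^sup>2 = -1\<close>.
  Hence the second kind is the only one, which is the content of \<open>sign_tensor_perm2\<close> and
  \<open>sign_tensor_ratio\<close>.

  Now look at the two control wires of the middle gate, with bases \<open>F\<close> and \<open>G\<close>. Each of them is
  linked to a target wire of an outer gate, with basis \<open>C\<close> and \<open>J\<close> respectively. So \<open>P\<^sub>F\<close> and
  \<open>P\<^sub>G\<close> anticommute with \<open>Z\<close>, and being transposes of \<open>P\<^sub>C\<close> and \<open>P\<^sub>J\<close> they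
  also anticommute with \<open>X\<close>. Both are therefore \<open>\<plusminus>Y\<close>, with upper right entries \<open>\<plusminus>\<i>\<close>, and
  \<open>(p q)\<^sup>2 = 1\<close>: a contradiction.

  The proof below phrases all of this through polynomial identities in matrix entries. For an
  invertible \<open>M\<close> the reflection \<open>P\<^sub>M\<close> anticommutes with \<open>Z\<close> exactly when the permanent of \<open>M\<close>
  vanishes, its off-diagonal entries are \<open>2 M\<^sub>0\<^sub>1 M\<^sub>1\<^sub>1 / det M\<close> and \<open>-2 M\<^sub>0\<^sub>0 M\<^sub>1\<^sub>0 / det M\<close>,
  and passing from \<open>Z\<close> to \<open>X\<close> amounts to replacing \<open>M\<close> by its product with a Hadamard matrix.
\<close>

section \<open>Pfaffians of size at most four\<close>

lemma pfaffian_dim_0: "dim_row A = 0 \<Longrightarrow> pfaffian A = 1"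
  unfolding pfaffian_def by simp

lemma pfaffian_dim_2:
  assumes "dim_row A = 2"
  shows "pfaffian A = (A $$ (0,1) - A $$ (1,0)) / 2"
proof -
  define f where "f p = complex_of_int (sign p) * A $$ (p 0, p 1)" for p
  have e: "{..<2::nat} = insert 0 {1}" "{..<Suc 0} = {0::nat}" by auto
  have "pfaffian A = sum f {p. p permutes insert 0 {1}} / 2"
    using assms unfolding pfaffian_def f_def by (simp add: Let_def e)
  also have "sum f {p. p permutes insert 0 {1::nat}} = A $$ (0,1) - A $$ (1,0)"
    by (subst sum_over_permutations_insert) (simp_all add: f_def sign_swap_id sign_compose permutation_swap_id permutation_id)
  finally show ?thesis .
qed

text \<open>
  The sum over all permutations antisymmetrises every entry, and
  each of the three perfect matchings of four points then collects its eight permutations.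
\<close>

lemma pfaffian_dim_4:
  assumes "dim_row A = 4"
  shows "pfaffian A = ((A $$ (0,1) - A $$ (1,0)) * (A $$ (2,3) - A $$ (3,2))
     - (A $$ (0,2) - A $$ (2,0)) * (A $$ (1,3) - A $$ (3,1))
     + (A $$ (0,3) - A $$ (3,0)) * (A $$ (1,2) - A $$ (2,1))) / 4" (is "_ = ?P / 4")
proof -
  define f where "f p = complex_of_int (sign p) * (A $$ (p 0, p 1) * A $$ (p 2, p 3))" for p
  have e: "{..<4::nat} = {0,1,2,3}" and e2: "{..<2::nat} = {0,1}" by auto
  have f: "finite {1::nat,2,3}" "0 \<notin> {1::nat,2,3}" "finite {2::nat,3}" "1 \<notin> {2::nat,3}"
    "finite {3::nat}" "2 \<notin> {3::nat}" by auto
  have "pfaffian A = sum f {p. p permutes {..<4}} / 8"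
    using assms unfolding pfaffian_def f_def by (simp add: Let_def e2)
  moreover have "sum f {p. p permutes {..<4}} = 2 * ?P"
    unfolding e sum_over_permutations_insert[OF f(1,2)] sum_over_permutations_insert[OF f(3,4)]
      sum_over_permutations_insert[OF f(5,6)] permutes_sing
    by (simp add: f_def sign_compose permutation_compose permutation_swap_id permutation_id
        sign_swap_id sign_id transpose_apply_other algebra_simps)
  ultimately show ?thesis by (simp only: times_divide_eq_left) simp
qed

lemma skew_symmetric_entry:
  assumes "A \<in> carrier_mat n n" "skew_symmetric A" "i < n" "j < n"
  shows "A $$ (j,i) = - A $$ (i,j)"
proof -
  have "transpose_mat A $$ (i,j) = (- A) $$ (i,j)" using assms(2) unfolding skew_symmetric_def by simp
  thus ?thesis using assms(1,3,4) by simp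
qed

lemma submatrix_full:
  assumes "A \<in> carrier_mat n n"
  shows "submatrix A {..<n} {..<n} = A"
proof -
  have p: "pick {..<n} i = i" if "i < n" for i
  proof -
    have "{a \<in> {..<n}. a < i} = {..<i}" using that by auto
    thus ?thesis using pick_card_in_set[of i "{..<n}"] that by simp
  qed
  have c: "{i. i < n \<and> i \<in> {..<n}} = {..<n}" by auto
  show ?thesis
    unfolding submatrix_def carrier_matD[OF assms] c card_lessThan
    using assms p by (intro eq_matI) simp_all
qed

lemma card_inter_below: "{i. i < n \<and> i \<in> S} = S" if "S \<subseteq> {..<n}" for S :: "nat set"
  using that by auto

lemma pfaffian_odd_submatrix:
  assumes "A \<in> carrier_mat n n" "S \<subseteq> {..<n}" "odd (card S)"
  shows "pfaffian (submatrix A S S) = 0"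
  using assms by (simp add: pfaffian_def dim_submatrix card_inter_below)

lemma pfaffian_pair_submatrix:
  assumes A: "A \<in> carrier_mat n n" "skew_symmetric A" and ij: "i < j" "j < n"
  shows "pfaffian (submatrix A {i,j} {i,j}) = A $$ (i,j)"
proof -
  have c: "card {a \<in> {i,j}. a < i} = 0" "card {a \<in> {i,j}. a < j} = 1"
  proof -
    have "{a \<in> {i,j}. a < i} = {}" "{a \<in> {i,j}. a < j} = {i}" using ij by auto
    thus "card {a \<in> {i,j}. a < i} = 0" "card {a \<in> {i,j}. a < j} = 1" by simp_all
  qed
  have "submatrix A {i,j} {i,j} $$ (0,1) = A $$ (i,j)" "submatrix A {i,j} {i,j} $$ (1,0) = A $$ (j,i)"
    using submatrix_index_card[of i A j "{i,j}" "{i,j}"] submatrix_index_card[of j A i "{i,j}" "{i,j}"] A(1) ij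
    unfolding c by auto
  moreover have "A $$ (j,i) = - A $$ (i,j)"
    by (rule skew_symmetric_entry[OF A]) (use ij in simp_all)
  moreover have "{k. k < n \<and> k \<in> {i,j}} = {i,j}" using ij by auto
  hence "dim_row (submatrix A {i,j} {i,j}) = 2"
    unfolding dim_submatrix using A(1) ij by (simp only: carrier_matD card_2_iff) blast
  ultimately show ?thesis by (simp add: pfaffian_dim_2)
qed

lemma pfaffian_skew_dim_4:
  assumes A: "A \<in> carrier_mat 4 4" "skew_symmetric A"
  shows "pfaffian A = A $$ (0,1) * A $$ (2,3) - A $$ (0,2) * A $$ (1,3) + A $$ (0,3) * A $$ (1,2)"
proof -
  have flip: "A $$ (1,0) = - A $$ (0,1)" "A $$ (2,0) = - A $$ (0,2)" "A $$ (3,0) = - A $$ (0,3)"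
    "A $$ (2,1) = - A $$ (1,2)" "A $$ (3,1) = - A $$ (1,3)" "A $$ (3,2) = - A $$ (2,3)"
    by (rule skew_symmetric_entry[OF A]; force)+
  have dim: "dim_row A = 4" using A(1) by simp
  have double: "(x - - x) * (y - - y) = 4 * (x * y)" for x y :: complex
    by (simp add: algebra_simps)
  have quarter: "(4 * p - 4 * q + 4 * r) / 4 = p - q + r" for p q r :: complex
    by (simp add: field_simps)
  show ?thesis unfolding pfaffian_dim_4[OF dim] flip double by (rule quarter)
qed

section \<open>Coordinates of Pfaffian gates and cogates\<close>

lemma indicator_bits_inj: "inj_on (indicator_bits n) (Pow {..<n})"
proof (rule inj_onI)
  fix S T assume ST: "S \<in> Pow {..<n}" "T \<in> Pow {..<n}" and e: "indicator_bits n S = indicator_bits n T"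
  have nth: "indicator_bits n R ! i = (if i \<in> R then 1 else 0)" if "i < n" for i R
    using that by (simp add: indicator_bits_def)
  have bits: "i \<in> S \<longleftrightarrow> i \<in> T" if "i < n" for i
  proof -
    have "(if i \<in> S then 1 else 0) = (if i \<in> T then 1 else (0::nat))"
      using nth[OF that, of S] nth[OF that, of T] e by (simp only:)
    thus ?thesis by (cases "i \<in> S"; cases "i \<in> T") simp_all
  qed
  show "S = T"
  proof (rule Set.set_eqI)
    fix i
    show "i \<in> S \<longleftrightarrow> i \<in> T"
    proof (cases "i < n")
      case True thus ?thesis by (rule bits)
    next
      case False thus ?thesis using ST by blast
    qed
  qed
qed

lemma sum_indicator_bits:
  assumes "S \<subseteq> {..<n}"
  shows "(\<Sum>T\<in>Pow {..<n}. f T * (if indicator_bits n S = indicator_bits n T then 1 else 0)) = (f S :: complex)"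
proof -
  have "(\<Sum>T\<in>Pow {..<n}. f T * (if indicator_bits n S = indicator_bits n T then 1 else 0)) =
    (\<Sum>T\<in>Pow {..<n}. if S = T then f T else 0)"
    using assms indicator_bits_inj[of n] by (intro sum.cong) (auto simp: inj_on_def)
  also have "\<dots> = f S" using assms by (subst sum.delta') auto
  finally show ?thesis .
qed

lemma sPf_indicator_bits:
  assumes "\<Xi> \<in> carrier_mat n n" "S \<subseteq> {..<n}"
  shows "sPf \<Xi> (indicator_bits n S) = pfaffian (submatrix \<Xi> S S)"
  using sum_indicator_bits[OF assms(2)] assms(1) by (simp add: sPf_def ket_def)

lemma sPf_star_indicator_bits:
  assumes "\<Theta> \<in> carrier_mat n n" "S \<subseteq> {..<n}"
  shows "sPf_star \<Theta> (indicator_bits n S) = pfaffian (submatrix \<Theta> ({..<n} - S) ({..<n} - S))"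
  using sum_indicator_bits[OF assms(2), of "\<lambda>S. pfaffian (submatrix \<Theta> ({..<n} - S) ({..<n} - S))"] assms(1)
  by (simp add: sPf_star_def bra_def)

text \<open>
  The coordinate form of being a nonzero multiple of a sub-Pfaffian tensor of arity 4: even parity,
  and the expansion of a \<open>4 \<times> 4\<close> Pfaffian, made homogeneous by the empty Pfaffian \<open>t 0 0 0 0\<close>.
\<close>

definition matchgate4 :: "(nat \<Rightarrow> nat \<Rightarrow> nat \<Rightarrow> nat \<Rightarrow> complex) \<Rightarrow> bool" where
  "matchgate4 t \<longleftrightarrow> t 0 0 0 0 \<noteq> 0 \<and>
     t 0 0 0 1 = 0 \<and> t 0 0 1 0 = 0 \<and> t 0 1 0 0 = 0 \<and> t 1 0 0 0 = 0 \<and>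
     t 1 1 1 0 = 0 \<and> t 1 1 0 1 = 0 \<and> t 1 0 1 1 = 0 \<and> t 0 1 1 1 = 0 \<and>
     t 0 0 0 0 * t 1 1 1 1 = t 1 1 0 0 * t 0 0 1 1 - t 1 0 1 0 * t 0 1 0 1 + t 1 0 0 1 * t 0 1 1 0"

text \<open>
  Exchanging the first two wires and the last two wires fixes the first product on the right of the
  quadratic relation and exchanges the factors of each of the other two, so the signs survive. This
  makes the two CNOT gates, and control and target wires within one gate, interchangeable.
\<close>

lemma matchgate4_swap: "matchgate4 (\<lambda>x y z w. t y x w z) \<longleftrightarrow> matchgate4 t"
  unfolding matchgate4_def
  by (simp only: mult.commute[of "t 0 1 0 1" "t 1 0 1 0"] mult.commute[of "t 0 1 1 0" "t 1 0 0 1"] conj_ac)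

lemma matchgate4_scale:
  assumes "matchgate4 t" "k \<noteq> 0"
    and s: "\<And>x y z w. {x,y,z,w} \<subseteq> {0,1} \<Longrightarrow> s x y z w = k * t x y z w"
  shows "matchgate4 s"
proof -
  have quad: "t 0 0 0 0 * t 1 1 1 1 = t 1 1 0 0 * t 0 0 1 1 - t 1 0 1 0 * t 0 1 0 1 + t 1 0 0 1 * t 0 1 1 0"
    using assms(1) unfolding matchgate4_def by blast
  have "k * t 0 0 0 0 * (k * t 1 1 1 1) = k * k * (t 0 0 0 0 * t 1 1 1 1)" by (simp only: mult_ac)
  also have "\<dots> = k * t 1 1 0 0 * (k * t 0 0 1 1) - k * t 1 0 1 0 * (k * t 0 1 0 1) + k * t 1 0 0 1 * (k * t 0 1 1 0)"
    unfolding quad by (simp add: algebra_simps)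
  finally show ?thesis
    using assms(1,2) unfolding matchgate4_def by (simp add: s)
qed

lemma pfaffian_gate_matchgate4:
  assumes "pfaffian_gate_under T Ms" "length Ms = 4" "\<exists>b. act_gate Ms T b \<noteq> 0"
  shows "matchgate4 (\<lambda>x y z w. act_gate Ms T [x,y,z,w])"
proof -
  from assms obtain \<alpha> \<Xi> where X: "\<Xi> \<in> carrier_mat 4 4" "skew_symmetric \<Xi>"
    and T: "act_gate Ms T = (\<lambda>b. \<alpha> * sPf \<Xi> b)"
    unfolding pfaffian_gate_under_def by auto
  have a: "\<alpha> \<noteq> 0" using assms(3) unfolding T by auto
  have ind: "indicator_bits 4 S = [if 0 \<in> S then 1 else 0, if 1 \<in> S then 1 else 0,
     if 2 \<in> S then 1 else 0, if 3 \<in> S then 1 else 0]" for S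
  proof -
    have "[0..<4] = [0,1,2,3::nat]" by code_simp
    thus ?thesis unfolding indicator_bits_def by simp
  qed
  have o: "act_gate Ms T (indicator_bits 4 S) = 0" if "S \<subseteq> {..<4}" "odd (card S)" for S
    unfolding T sPf_indicator_bits[OF X(1) that(1)] pfaffian_odd_submatrix[OF X(1) that] by simp
  have e: "act_gate Ms T (indicator_bits 4 {i,j}) = \<alpha> * \<Xi> $$ (i,j)" if "i < j" "j < 4" for i j
    unfolding T using that sPf_indicator_bits[OF X(1), of "{i,j}"] pfaffian_pair_submatrix[OF X that] by simp
  have z: "act_gate Ms T (indicator_bits 4 {}) = \<alpha>"
    unfolding T sPf_indicator_bits[OF X(1) empty_subsetI] by (simp add: pfaffian_dim_0 dim_submatrix)
  have f: "act_gate Ms T (indicator_bits 4 {..<4}) = \<alpha> * pfaffian \<Xi>"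
    unfolding T sPf_indicator_bits[OF X(1) subset_refl] submatrix_full[OF X(1)] ..
  note o = o[of "{0}"] o[of "{1}"] o[of "{2}"] o[of "{3}"]
    o[of "{0,1,2}"] o[of "{0,1,3}"] o[of "{0,2,3}"] o[of "{1,2,3}"]
  note e = e[of 0 1] e[of 0 2] e[of 0 3] e[of 1 2] e[of 1 3] e[of 2 3]
  have "\<alpha> * (\<alpha> * pfaffian \<Xi>) = \<alpha> * \<Xi> $$ (0,1) * (\<alpha> * \<Xi> $$ (2,3)) -
      \<alpha> * \<Xi> $$ (0,2) * (\<alpha> * \<Xi> $$ (1,3)) + \<alpha> * \<Xi> $$ (0,3) * (\<alpha> * \<Xi> $$ (1,2))"
    unfolding pfaffian_skew_dim_4[OF X] by (simp add: algebra_simps)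
  thus ?thesis
    using o e z f a unfolding matchgate4_def ind by simp
qed

lemma pfaffian_cogate_odd:
  assumes "pfaffian_cogate_under T Ms" "length Ms = 2"
  shows "act_cogate Ms T [0,1] = 0" "act_cogate Ms T [1,0] = 0"
proof -
  from assms obtain \<beta> \<Theta> where X: "\<Theta> \<in> carrier_mat 2 2"
    and T: "act_cogate Ms T = (\<lambda>b. \<beta> * sPf_star \<Theta> b)"
    unfolding pfaffian_cogate_under_def by auto
  have ind: "indicator_bits 2 S = [if 0 \<in> S then 1 else 0, if 1 \<in> S then 1 else 0]" for S
  proof -
    have "[0..<2] = [0,1::nat]" by code_simp
    thus ?thesis unfolding indicator_bits_def by simp
  qed
  have o: "act_cogate Ms T (indicator_bits 2 S) = 0" if "S \<subseteq> {..<2}" "card S = 1" for S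
  proof -
    have "odd (card ({..<2} - S))" using that by (simp add: card_Diff_subset finite_subset)
    thus ?thesis
      unfolding T sPf_star_indicator_bits[OF X that(1)] using pfaffian_odd_submatrix[OF X, of "{..<2} - S"] by simp
  qed
  show "act_cogate Ms T [0,1] = 0" "act_cogate Ms T [1,0] = 0"
    using o[of "{1}"] o[of "{0}"] unfolding ind by simp_all
qed

section \<open>Local changes of basis in coordinates\<close>

lemma finite_bitstrings: "finite (bitstrings n)"
proof -
  have "bitstrings n = {b. set b \<subseteq> {0, 1} \<and> length b = n}" unfolding bitstrings_def by auto
  thus ?thesis using finite_lists_length_eq[of "{0,1::nat}" n] by simp
qed

lemma act_gate_add:
  "act_gate Ms (\<lambda>b. T b + U b) = (\<lambda>b. act_gate Ms T b + act_gate Ms U b)"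
  unfolding act_gate_def by (auto simp: distrib_left sum.distrib)

lemma act_cogate_add:
  "act_cogate Ms (\<lambda>b. T b + U b) = (\<lambda>b. act_cogate Ms T b + act_cogate Ms U b)"
  unfolding act_cogate_def by (auto simp: distrib_left sum.distrib)

lemma act_gate_ket:
  assumes "b \<in> bitstrings (length Ms)" "c \<in> bitstrings (length Ms)"
  shows "act_gate Ms (ket c) b = (\<Prod>i<length Ms. Ms ! i $$ (b ! i, c ! i))"
  using assms finite_bitstrings by (simp add: act_gate_def ket_def if_distrib cong: if_cong)

lemma act_cogate_bra:
  assumes "b \<in> bitstrings (length Ms)" "c \<in> bitstrings (length Ms)"
  shows "act_cogate Ms (bra c) b = (\<Prod>i<length Ms. Ms ! i $$ (c ! i, b ! i))"
  using assms finite_bitstrings by (simp add: act_cogate_def bra_def if_distrib cong: if_cong)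

definition det2 :: "(nat \<Rightarrow> nat \<Rightarrow> complex) \<Rightarrow> complex" where
  "det2 m = m 0 0 * m 1 1 - m 0 1 * m 1 0"

text \<open>
  The permanent of a \<open>2 \<times> 2\<close> matrix. For invertible \<open>m\<close> the diagonal entries of \<open>m\<inverse> Z m\<close> are
  \<open>perm m / det m\<close> and \<open>- perm m / det m\<close>; so the permanent vanishes exactly when that reflection is
  antidiagonal.
\<close>

definition perm2 :: "(nat \<Rightarrow> nat \<Rightarrow> complex) \<Rightarrow> complex" where
  "perm2 m = m 0 0 * m 1 1 + m 0 1 * m 1 0"

lemma entries_nonzero:
  assumes "perm2 m = 0" "det2 m \<noteq> 0"
  shows "m 0 0 \<noteq> 0" "m 0 1 \<noteq> 0" "m 1 0 \<noteq> 0" "m 1 1 \<noteq> 0"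
  using assms unfolding perm2_def det2_def by auto

lemma perm2_zero_columns:
  assumes "perm2 m = 0" "det2 m \<noteq> 0"
  obtains t where "m 0 1 = t * m 0 0" "m 1 1 = - t * m 1 0"
proof
  note nz = entries_nonzero[OF assms]
  show "m 0 1 = m 0 1 / m 0 0 * m 0 0" using nz by simp
  have "m 0 0 * m 1 1 = m 0 0 * (- (m 0 1 / m 0 0) * m 1 0)"
    using assms(1) nz unfolding perm2_def by (simp add: eq_neg_iff_add_eq_0)
  thus "m 1 1 = - (m 0 1 / m 0 0) * m 1 0" using mult_left_cancel[OF nz(1)] by blast
qed

abbreviation entries :: "complex mat \<Rightarrow> nat \<Rightarrow> nat \<Rightarrow> complex" where
  "entries M \<equiv> \<lambda>x j. M $$ (x, j)"

definition hadamard :: "(nat \<Rightarrow> nat \<Rightarrow> complex) \<Rightarrow> nat \<Rightarrow> nat \<Rightarrow> complex" where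
  "hadamard m = (\<lambda>x j. if j = 0 then m x 0 + m x 1 else m x 0 - m x 1)"

lemma det2_hadamard: "det2 (hadamard m) = - 2 * det2 m"
  unfolding det2_def hadamard_def by (simp add: algebra_simps)

lemma perm2_hadamard: "perm2 (hadamard m) = 2 * (m 0 0 * m 1 0 - m 0 1 * m 1 1)"
  unfolding perm2_def hadamard_def by (simp add: algebra_simps)

lemma mat_inv_correct:
  assumes M: "M \<in> carrier_mat n n" "invertible_mat M"
  shows "mat_inv M \<in> carrier_mat n n" "M * mat_inv M = 1\<^sub>m n"
proof -
  obtain B where B: "M * B = 1\<^sub>m n" "B * M = 1\<^sub>m (dim_row B)"
    using assms unfolding invertible_mat_def inverts_mat_def by auto
  have "dim_col (M * B) = n" "dim_col (B * M) = dim_row B" unfolding B by simp_all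
  hence "B \<in> carrier_mat n n" using M(1) by auto
  hence "M \<in> Units (ring_mat TYPE(complex) n ())"
    using B M(1) unfolding Units_def ring_mat_def by auto
  then obtain N where N: "mat_inverse M = Some N"
    using mat_inverse(1)[OF M(1), where b = "()"] by (cases "mat_inverse M") auto
  thus "mat_inv M \<in> carrier_mat n n" "M * mat_inv M = 1\<^sub>m n"
    using mat_inverse(2)[OF M(1) N] unfolding mat_inv_def by auto
qed

lemma mat_mult_2_entry:
  assumes "M \<in> carrier_mat 2 2" "N \<in> carrier_mat 2 2" "i < 2" "j < 2"
  shows "(M * N) $$ (i,j) = M $$ (i,0) * N $$ (0,j) + M $$ (i,1) * N $$ (1,j)"
proof -
  have "{0..<2::nat} = {0,1}" by auto
  thus ?thesis using assms by (simp add: scalar_prod_def)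
qed

text \<open>
  The inverse of a \<open>2 \<times> 2\<close> matrix is its adjugate divided by the determinant; stated without
  division, for use in polynomial identities.
\<close>

lemma mat_inv_entries:
  assumes M: "M \<in> carrier_mat 2 2" "invertible_mat M"
  shows "det2 (entries M) \<noteq> 0"
    and "det2 (entries M) * mat_inv M $$ (0,0) = M $$ (1,1)"
    and "det2 (entries M) * mat_inv M $$ (0,1) = - M $$ (0,1)"
    and "det2 (entries M) * mat_inv M $$ (1,0) = - M $$ (1,0)"
    and "det2 (entries M) * mat_inv M $$ (1,1) = M $$ (0,0)"
proof -
  let ?N = "mat_inv M"
  have e: "M $$ (i,0) * ?N $$ (0,j) + M $$ (i,1) * ?N $$ (1,j) = (if i = j then 1 else 0)"
    if "i < 2" "j < 2" for i j
    using mat_mult_2_entry[OF M(1) mat_inv_correct(1)[OF M] that] that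
    unfolding mat_inv_correct(2)[OF M] by simp
  have e00: "M $$ (0,0) * ?N $$ (0,0) + M $$ (0,1) * ?N $$ (1,0) = 1"
    and e01: "M $$ (0,0) * ?N $$ (0,1) + M $$ (0,1) * ?N $$ (1,1) = 0"
    and e10: "M $$ (1,0) * ?N $$ (0,0) + M $$ (1,1) * ?N $$ (1,0) = 0"
    and e11: "M $$ (1,0) * ?N $$ (0,1) + M $$ (1,1) * ?N $$ (1,1) = 1"
    using e[of 0 0] e[of 0 1] e[of 1 0] e[of 1 1] by simp_all
  have "det2 (entries M) * det2 (entries ?N) =
      (M $$ (0,0) * ?N $$ (0,0) + M $$ (0,1) * ?N $$ (1,0)) * (M $$ (1,0) * ?N $$ (0,1) + M $$ (1,1) * ?N $$ (1,1)) -
      (M $$ (0,0) * ?N $$ (0,1) + M $$ (0,1) * ?N $$ (1,1)) * (M $$ (1,0) * ?N $$ (0,0) + M $$ (1,1) * ?N $$ (1,0))"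
    unfolding det2_def by (simp add: algebra_simps)
  also have "\<dots> = 1" unfolding e00 e01 e10 e11 by simp
  finally show "det2 (entries M) \<noteq> 0" by auto
  have cramer: "det2 (entries M) * ?N $$ (0,j) =
      M $$ (1,1) * (M $$ (0,0) * ?N $$ (0,j) + M $$ (0,1) * ?N $$ (1,j)) -
      M $$ (0,1) * (M $$ (1,0) * ?N $$ (0,j) + M $$ (1,1) * ?N $$ (1,j))"
    "det2 (entries M) * ?N $$ (1,j) =
      M $$ (0,0) * (M $$ (1,0) * ?N $$ (0,j) + M $$ (1,1) * ?N $$ (1,j)) -
      M $$ (1,0) * (M $$ (0,0) * ?N $$ (0,j) + M $$ (0,1) * ?N $$ (1,j))" for j
    unfolding det2_def by (simp_all add: algebra_simps)
  show "det2 (entries M) * ?N $$ (0,0) = M $$ (1,1)" "det2 (entries M) * ?N $$ (0,1) = - M $$ (0,1)"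
    "det2 (entries M) * ?N $$ (1,0) = - M $$ (1,0)" "det2 (entries M) * ?N $$ (1,1) = M $$ (0,0)"
    unfolding cramer e00 e01 e10 e11 by simp_all
qed

section \<open>The tensor of signs\<close>

text \<open>
  The tensor \<open>\<Sum>j k. (-1)^(j k) a\<^sub>j \<otimes> b\<^sub>k \<otimes> c\<^sub>k \<otimes> d\<^sub>j\<close>, where \<open>m\<^sub>j\<close> is column \<open>j\<close> of \<open>m\<close>. A CNOT
  gate takes this form, up to a factor, once its target wires are written in the eigenbasis of the bit flip. In this
  form control wires \<open>a, d\<close> and target wires \<open>b, c\<close> play symmetric roles, and each entry is the value
  of the nondegenerate bilinear form \<open>p (r + s) + q (r - s)\<close> at a vector \<open>(p, q)\<close> that depends only on
  \<open>x, w\<close> and a vector \<open>(r, s)\<close> that depends only on \<open>y, z\<close>.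
\<close>

definition sign_tensor ::
  "(nat \<Rightarrow> nat \<Rightarrow> complex) \<Rightarrow> (nat \<Rightarrow> nat \<Rightarrow> complex) \<Rightarrow> (nat \<Rightarrow> nat \<Rightarrow> complex) \<Rightarrow>
   (nat \<Rightarrow> nat \<Rightarrow> complex) \<Rightarrow> nat \<Rightarrow> nat \<Rightarrow> nat \<Rightarrow> nat \<Rightarrow> complex" where
  "sign_tensor a b c d x y z w =
     a x 0 * d w 0 * (b y 0 * c z 0 + b y 1 * c z 1) +
     a x 1 * d w 1 * (b y 0 * c z 0 - b y 1 * c z 1)"

lemma sign_tensor_swap: "sign_tensor b a d c y x w z = sign_tensor a b c d x y z w"
  unfolding sign_tensor_def by (simp add: algebra_simps)

text \<open>
  Contracting with the adjugates of \<open>a\<close> and \<open>d\<close> recovers, up to the factor \<open>det a det d\<close>, the matrix \<open>u = b c\<^sup>T\<close>, which is invertible.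
\<close>

lemma sign_tensor_nonzero:
  assumes "det2 a \<noteq> 0" "det2 b \<noteq> 0" "det2 c \<noteq> 0" "det2 d \<noteq> 0"
  shows "\<exists>x y z w. {x,y,z,w} \<subseteq> {0,1} \<and> sign_tensor a b c d x y z w \<noteq> 0"
proof (rule ccontr)
  assume "\<not> ?thesis"
  hence zero: "sign_tensor a b c d x y z w = 0" if "{x,y,z,w} \<subseteq> {0,1}" for x y z w using that by blast
  define u where "u y z = b y 0 * c z 0 + b y 1 * c z 1" for y z
  have "u y z = 0" if "{y,z} \<subseteq> {0,1}" for y z
  proof -
    have "det2 a * det2 d * u y z =
      a 1 1 * d 1 1 * sign_tensor a b c d 0 y z 0 - a 1 1 * d 0 1 * sign_tensor a b c d 0 y z 1 -
      a 0 1 * d 1 1 * sign_tensor a b c d 1 y z 0 + a 0 1 * d 0 1 * sign_tensor a b c d 1 y z 1"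
      unfolding u_def sign_tensor_def det2_def by (simp add: algebra_simps)
    thus ?thesis using that assms zero by simp
  qed
  moreover have "det2 b * det2 c = u 0 0 * u 1 1 - u 0 1 * u 1 0"
    unfolding u_def det2_def by (simp add: algebra_simps)
  ultimately show False using assms by simp
qed

text \<open>
  A vector that is orthogonal, for the bilinear form above, to two independent vectors is zero.
\<close>

lemma orthogonal_to_independent:
  fixes p q r s r' s' :: complex
  assumes "p * (r + s) + q * (r - s) = 0" "p * (r' + s') + q * (r' - s') = 0" "r * s' - r' * s \<noteq> 0"
  shows "p = 0" "q = 0"
proof -
  have "2 * (r * s' - r' * s) * p =
      (r - s) * (p * (r' + s') + q * (r' - s')) - (r' - s') * (p * (r + s) + q * (r - s))"
    and "2 * (r * s' - r' * s) * q =
      (r' + s') * (p * (r + s) + q * (r - s)) - (r + s) * (p * (r' + s') + q * (r' - s'))"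
    by (simp_all add: algebra_simps)
  hence "2 * (r * s' - r' * s) * p = 0" "2 * (r * s' - r' * s) * q = 0"
    unfolding assms(1,2) by simp_all
  thus "p = 0" "q = 0" using assms(3) by auto
qed

text \<open>
  The Gram determinant of two pairs of vectors for the bilinear form, whose own determinant is \<open>-2\<close>.
\<close>

lemma gram_det:
  fixes p q r s p' q' r' s' :: complex
  shows "(p * (r + s) + q * (r - s)) * (p' * (r' + s') + q' * (r' - s')) -
    (p' * (r + s) + q' * (r - s)) * (p * (r' + s') + q * (r' - s')) =
    - 2 * ((p * q' - p' * q) * (r * s' - r' * s))"
  by (simp add: algebra_simps)

text \<open>
  Both conclusions say that two vectors \<open>(r, s)\<close> are linearly dependent: those of the even pairs
  \<open>(y, z) = (0, 0), (1, 1)\<close>, and those of the odd pairs. By even parity, the vectors of even pairs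
  \<open>(y, z)\<close> are orthogonal to those of odd pairs \<open>(x, w)\<close>, and conversely. If the even vectors were
  independent, all odd vectors \<open>(p, q)\<close> would vanish; the quadratic relation then says that a Gram
  determinant is zero, whereas the invertibility of \<open>a\<close> and \<open>d\<close> makes the even vectors \<open>(p, q)\<close>
  independent. If the odd vectors were independent, all even vectors \<open>(p, q)\<close> would vanish, and with
  them the entry at \<open>0 0 0 0\<close>.
\<close>

lemma sign_tensor_dependent:
  assumes mg: "matchgate4 (sign_tensor a b c d)" and da: "det2 a \<noteq> 0" "det2 d \<noteq> 0"
  shows "b 0 0 * c 0 0 * (b 1 1 * c 1 1) = b 1 0 * c 1 0 * (b 0 1 * c 0 1)"
    and "b 0 0 * c 1 0 * (b 1 1 * c 0 1) = b 1 0 * c 0 0 * (b 0 1 * c 1 1)"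
proof -
  have odd: "sign_tensor a b c d 0 0 0 1 = 0" "sign_tensor a b c d 0 1 1 1 = 0"
    "sign_tensor a b c d 1 0 0 0 = 0" "sign_tensor a b c d 1 1 1 0 = 0"
    "sign_tensor a b c d 0 0 1 0 = 0" "sign_tensor a b c d 0 1 0 0 = 0"
    using mg unfolding matchgate4_def by blast+
  note odd = odd[unfolded sign_tensor_def]
  show "b 0 0 * c 0 0 * (b 1 1 * c 1 1) = b 1 0 * c 1 0 * (b 0 1 * c 0 1)"
  proof (rule ccontr)
    assume "\<not> ?thesis"
    hence ne: "b 0 0 * c 0 0 * (b 1 1 * c 1 1) - b 1 0 * c 1 0 * (b 0 1 * c 0 1) \<noteq> 0" by simp
    have z: "a 0 0 * d 1 0 = 0" "a 0 1 * d 1 1 = 0" "a 1 0 * d 0 0 = 0" "a 1 1 * d 0 1 = 0"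
      using orthogonal_to_independent[OF odd(1,2) ne] orthogonal_to_independent[OF odd(3,4) ne] .
    define P Q where "P = a 0 0 * d 0 0 * (a 1 1 * d 1 1)" and "Q = a 1 0 * d 1 0 * (a 0 1 * d 0 1)"
    \<comment> \<open>\<open>P - Q\<close> is the determinant of the even vectors \<open>(p, q)\<close>; it is nonzero as \<open>P + Q\<close> is and \<open>P Q = 0\<close>.\<close>
    have "det2 a * det2 d = P + Q - a 0 0 * d 1 0 * (a 1 1 * d 0 1) - a 0 1 * d 1 1 * (a 1 0 * d 0 0)"
      unfolding det2_def P_def Q_def by (simp add: algebra_simps)
    hence "det2 a * det2 d = P + Q" using z by auto
    moreover have "P * Q = 0" using z unfolding P_def Q_def by auto
    moreover have "(P - Q) * (b 0 0 * c 0 0 * (b 1 1 * c 1 1) - b 1 0 * c 1 0 * (b 0 1 * c 0 1)) = 0"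
    proof -
      have "sign_tensor a b c d 1 1 0 0 = 0" "sign_tensor a b c d 1 0 1 0 = 0"
        using z unfolding sign_tensor_def by auto
      hence "sign_tensor a b c d 0 0 0 0 * sign_tensor a b c d 1 1 1 1 = 
         sign_tensor a b c d 1 0 0 1 * sign_tensor a b c d 0 1 1 0"
        using mg unfolding matchgate4_def by simp
      moreover have "sign_tensor a b c d 0 0 0 0 * sign_tensor a b c d 1 1 1 1 -
          sign_tensor a b c d 1 0 0 1 * sign_tensor a b c d 0 1 1 0 =
        - 2 * ((P - Q) * (b 0 0 * c 0 0 * (b 1 1 * c 1 1) - b 1 0 * c 1 0 * (b 0 1 * c 0 1)))"
        unfolding sign_tensor_def gram_det P_def Q_def by (simp add: mult_ac)
      ultimately have "2 * ((P - Q) * (b 0 0 * c 0 0 * (b 1 1 * c 1 1) - b 1 0 * c 1 0 * (b 0 1 * c 0 1))) = 0"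
        by simp
      thus ?thesis by simp
    qed
    ultimately show False using ne da by auto
  qed
  show "b 0 0 * c 1 0 * (b 1 1 * c 0 1) = b 1 0 * c 0 0 * (b 0 1 * c 1 1)"
  proof (rule ccontr)
    assume "\<not> ?thesis"
    hence ne: "b 0 0 * c 1 0 * (b 1 1 * c 0 1) - b 1 0 * c 0 0 * (b 0 1 * c 1 1) \<noteq> 0" by simp
    have "a 0 0 * d 0 0 = 0" "a 0 1 * d 0 1 = 0"
      using orthogonal_to_independent[OF odd(5,6) ne] .
    hence "sign_tensor a b c d 0 0 0 0 = 0" unfolding sign_tensor_def by auto
    thus False using mg unfolding matchgate4_def by blast
  qed
qed

text \<open>
  The sum and the difference of the two dependency relations factor into a determinant and a permanent.
\<close>

lemma perm2_zero_of_dependent: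
  assumes "b 0 0 * c 0 0 * (b 1 1 * c 1 1) = b 1 0 * c 1 0 * (b 0 1 * c 0 1)"
    and "b 0 0 * c 1 0 * (b 1 1 * c 0 1) = b 1 0 * c 0 0 * (b 0 1 * c 1 1)"
    and "det2 b \<noteq> 0" "det2 c \<noteq> 0"
  shows "perm2 b = 0" "perm2 c = 0"
proof -
  have "det2 b * perm2 c =
      (b 0 0 * c 0 0 * (b 1 1 * c 1 1) - b 1 0 * c 1 0 * (b 0 1 * c 0 1)) +
      (b 0 0 * c 1 0 * (b 1 1 * c 0 1) - b 1 0 * c 0 0 * (b 0 1 * c 1 1))"
    and "det2 c * perm2 b =
      (b 0 0 * c 0 0 * (b 1 1 * c 1 1) - b 1 0 * c 1 0 * (b 0 1 * c 0 1)) -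
      (b 0 0 * c 1 0 * (b 1 1 * c 0 1) - b 1 0 * c 0 0 * (b 0 1 * c 1 1))"
    unfolding det2_def perm2_def by (simp_all add: algebra_simps)
  hence "det2 b * perm2 c = 0" "det2 c * perm2 b = 0"
    using assms(1,2) by simp_all
  thus "perm2 b = 0" "perm2 c = 0" using assms(3,4) by auto
qed

text \<open>
  Dependency of the vectors \<open>(r, s)\<close> settles \<open>b\<close> and \<open>c\<close>; exchanging control and target wires settles
  \<open>a\<close> and \<open>d\<close>.
\<close>

lemma sign_tensor_perm2:
  assumes mg: "matchgate4 (sign_tensor a b c d)"
    and de: "det2 a \<noteq> 0" "det2 b \<noteq> 0" "det2 c \<noteq> 0" "det2 d \<noteq> 0"
  shows "perm2 a = 0" "perm2 b = 0" "perm2 c = 0" "perm2 d = 0"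
proof -
  show "perm2 b = 0" "perm2 c = 0"
    using perm2_zero_of_dependent[OF sign_tensor_dependent[OF mg de(1,4)] de(2,3)] .
  have "(\<lambda>x y z w. sign_tensor b a d c y x w z) = sign_tensor a b c d"
    by (intro ext) (rule sign_tensor_swap)
  hence mg': "matchgate4 (sign_tensor b a d c)"
    using mg matchgate4_swap[of "sign_tensor b a d c"] by (simp only:)
  show "perm2 a = 0" "perm2 d = 0"
    using perm2_zero_of_dependent[OF sign_tensor_dependent[OF mg' de(2,3)] de(1,4)] .
qed

text \<open>
  With vanishing permanents, the ratio \<open>q / p\<close> is a number \<open>\<mu>\<close> for even \<open>(x, w)\<close> and \<open>-\<mu>\<close> for odd
  ones, and \<open>s / r\<close> is similarly \<open>\<kappa>\<close> and \<open>-\<kappa>\<close>. The two parity conditions that relate \<open>\<mu>\<close> and \<open>\<kappa>\<close>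
  leave only \<open>\<mu>\<^sup>2 = -1\<close>.
\<close>

lemma sign_tensor_ratio:
  assumes mg: "matchgate4 (sign_tensor a b c d)"
    and de: "det2 a \<noteq> 0" "det2 b \<noteq> 0" "det2 c \<noteq> 0" "det2 d \<noteq> 0"
  shows "a 0 1 * a 1 1 * (d 0 1 * d 1 1) = - (a 0 0 * a 1 0 * (d 0 0 * d 1 0))"
proof -
  note p = sign_tensor_perm2[OF mg de]
  note nz = entries_nonzero[OF p(1) de(1)] entries_nonzero[OF p(2) de(2)]
    entries_nonzero[OF p(3) de(3)] entries_nonzero[OF p(4) de(4)]
  obtain ta where a: "a 0 1 = ta * a 0 0" "a 1 1 = - ta * a 1 0" using perm2_zero_columns[OF p(1) de(1)] .
  obtain tb where b: "b 0 1 = tb * b 0 0" "b 1 1 = - tb * b 1 0" using perm2_zero_columns[OF p(2) de(2)] .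
  obtain tc where c: "c 0 1 = tc * c 0 0" "c 1 1 = - tc * c 1 0" using perm2_zero_columns[OF p(3) de(3)] .
  obtain td where d: "d 0 1 = td * d 0 0" "d 1 1 = - td * d 1 0" using perm2_zero_columns[OF p(4) de(4)] .
  note t = a b c d
  have odd: "sign_tensor a b c d 0 0 1 0 = 0" "sign_tensor a b c d 0 0 0 1 = 0"
    using mg unfolding matchgate4_def by blast+
  define \<mu> where "\<mu> = ta * td"
  define \<kappa> where "\<kappa> = tb * tc"
  have "a 0 0 * d 0 0 * (b 0 0 * c 1 0) * (1 - \<kappa> + \<mu> * (1 + \<kappa>)) = sign_tensor a b c d 0 0 1 0"
    unfolding sign_tensor_def \<mu>_def \<kappa>_def t by (simp add: algebra_simps)
  hence 1: "1 - \<kappa> + \<mu> * (1 + \<kappa>) = 0" using odd(1) nz by simp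
  have "a 0 0 * d 1 0 * (b 0 0 * c 0 0) * (1 + \<kappa> - \<mu> * (1 - \<kappa>)) = sign_tensor a b c d 0 0 0 1"
    unfolding sign_tensor_def \<mu>_def \<kappa>_def t by (simp add: algebra_simps)
  hence 2: "1 + \<kappa> - \<mu> * (1 - \<kappa>) = 0" using odd(2) nz by simp
  \<comment> \<open>Eliminates \<open>\<kappa>\<close> from the two parity conditions.\<close>
  have "2 * (\<mu>\<^sup>2 + 1) =
      (1 + \<mu>) * (1 - \<kappa> + \<mu> * (1 + \<kappa>)) + (1 - \<mu>) * (1 + \<kappa> - \<mu> * (1 - \<kappa>))"
    by (simp add: algebra_simps power2_eq_square)
  also have "\<dots> = 0" unfolding 1 2 by simp
  finally have "\<mu>\<^sup>2 + 1 = 0" by (simp only: mult_eq_0_iff) simp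
  hence "\<mu>\<^sup>2 = -1" by (simp only: eq_neg_iff_add_eq_0)
  moreover have "a 0 1 * a 1 1 * (d 0 1 * d 1 1) = \<mu>\<^sup>2 * (a 0 0 * a 1 0 * (d 0 0 * d 1 0))"
    unfolding \<mu>_def t by (simp add: power2_eq_square)
  ultimately show ?thesis by simp
qed

section \<open>The CNOT gates\<close>

text \<open>
  The factor 2 is the normalisation of the Hadamard matrix: \<open>|00\<rangle> + |11\<rangle>\<close> and \<open>|01\<rangle> + |10\<rangle>\<close> on the target
  wires are half the sum and half the difference of \<open>(|0\<rangle> + |1\<rangle>) \<otimes> (|0\<rangle> + |1\<rangle>)\<close> and
  \<open>(|0\<rangle> - |1\<rangle>) \<otimes> (|0\<rangle> - |1\<rangle>)\<close>.
\<close>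

lemma act_gate_CNOT1:
  assumes "{x,y,z,w} \<subseteq> {0,1}"
  shows "2 * act_gate [A,B,C,D] CNOT1 [x,y,z,w] =
    sign_tensor (entries A) (hadamard (entries B)) (hadamard (entries C)) (entries D) x y z w"
proof -
  have "act_gate [A,B,C,D] (ket c) [x,y,z,w] =
      A $$ (x, c ! 0) * B $$ (y, c ! 1) * C $$ (z, c ! 2) * D $$ (w, c ! 3)" if "c \<in> bitstrings 4" for c
    using assms that by (subst act_gate_ket) (auto simp: bitstrings_def numeral_eq_Suc)
  thus ?thesis
    unfolding CNOT1_def act_gate_add sign_tensor_def hadamard_def
    by (simp add: bitstrings_def algebra_simps)
qed

text \<open>
  The second CNOT gate has its control on wires 2 and 3: it is the first one with the first two and
  the last two wires exchanged.
\<close>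

lemma act_gate_CNOT2:
  assumes "{x,y,z,w} \<subseteq> {0,1}"
  shows "2 * act_gate [E,F,G,H] CNOT2 [x,y,z,w] =
    sign_tensor (entries F) (hadamard (entries E)) (hadamard (entries H)) (entries G) y x w z"
proof -
  have "act_gate [E,F,G,H] (ket c) [x,y,z,w] =
      E $$ (x, c ! 0) * F $$ (y, c ! 1) * G $$ (z, c ! 2) * H $$ (w, c ! 3)" if "c \<in> bitstrings 4" for c
    using assms that by (subst act_gate_ket) (auto simp: bitstrings_def numeral_eq_Suc)
  thus ?thesis
    unfolding CNOT2_def act_gate_add sign_tensor_def hadamard_def
    by (simp add: bitstrings_def algebra_simps)
qed

lemma pfaffian_CNOT1_matchgate4:
  assumes "pfaffian_gate_under CNOT1 [A,B,C,D]"
    and "det2 (entries A) \<noteq> 0" "det2 (entries B) \<noteq> 0" "det2 (entries C) \<noteq> 0" "det2 (entries D) \<noteq> 0"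
  shows "matchgate4 (sign_tensor (entries A) (hadamard (entries B)) (hadamard (entries C)) (entries D))"
    (is "matchgate4 ?s")
proof -
  have "\<exists>x y z w. {x,y,z,w} \<subseteq> {0,1} \<and> ?s x y z w \<noteq> 0"
    by (rule sign_tensor_nonzero) (use assms in \<open>simp_all add: det2_hadamard\<close>)
  then obtain x y z w where bits: "{x,y,z,w} \<subseteq> {0,1}" and nz: "?s x y z w \<noteq> 0" by blast
  have "act_gate [A,B,C,D] CNOT1 [x,y,z,w] \<noteq> 0"
    using nz unfolding act_gate_CNOT1[OF bits, symmetric] by simp
  hence "matchgate4 (\<lambda>x y z w. act_gate [A,B,C,D] CNOT1 [x,y,z,w])"
    by (intro pfaffian_gate_matchgate4[OF assms(1)]) auto
  thus ?thesis
    by (rule matchgate4_scale[where k = 2]) (simp, rule act_gate_CNOT1[symmetric])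
qed

lemma pfaffian_CNOT2_matchgate4:
  assumes "pfaffian_gate_under CNOT2 [E,F,G,H]"
    and "det2 (entries E) \<noteq> 0" "det2 (entries F) \<noteq> 0" "det2 (entries G) \<noteq> 0" "det2 (entries H) \<noteq> 0"
  shows "matchgate4 (sign_tensor (entries F) (hadamard (entries E)) (hadamard (entries H)) (entries G))"
    (is "matchgate4 ?s")
proof -
  have "\<exists>y x w z. {y,x,w,z} \<subseteq> {0,1} \<and> ?s y x w z \<noteq> 0"
    by (rule sign_tensor_nonzero) (use assms in \<open>simp_all add: det2_hadamard\<close>)
  then obtain y x w z where "{y,x,w,z} \<subseteq> {0,1}" and nz: "?s y x w z \<noteq> 0" by blast
  hence bits: "{x,y,z,w} \<subseteq> {0,1}" unfolding insert_subset by blast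
  have "act_gate [E,F,G,H] CNOT2 [x,y,z,w] \<noteq> 0"
    using nz unfolding act_gate_CNOT2[OF bits, symmetric] by simp
  hence "matchgate4 (\<lambda>x y z w. act_gate [E,F,G,H] CNOT2 [x,y,z,w])"
    by (intro pfaffian_gate_matchgate4[OF assms(1)]) auto
  hence "matchgate4 (\<lambda>x y z w. ?s y x w z)"
    by (rule matchgate4_scale[where k = 2]) (simp, rule act_gate_CNOT2[symmetric])
  thus ?thesis using matchgate4_swap[of ?s] by (rule iffD1[rotated])
qed

section \<open>Edges with an EQUAL cogate\<close>

lemma act_cogate_EQ:
  assumes "{x,y} \<subseteq> {0,1}"
  shows "act_cogate [P,Q] EQ [x,y] = P $$ (0,x) * Q $$ (0,y) + P $$ (1,x) * Q $$ (1,y)"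
proof -
  have "act_cogate [P,Q] (bra c) [x,y] = P $$ (c ! 0, x) * Q $$ (c ! 1, y)" if "c \<in> bitstrings 2" for c
    using assms that by (subst act_cogate_bra) (auto simp: bitstrings_def numeral_eq_Suc)
  thus ?thesis
    unfolding EQ_def act_cogate_add by (simp add: bitstrings_def)
qed

text \<open>
  By parity the matrix of the EQUAL cogate in the new basis is diagonal, and hence so is its inverse
  \<open>F C\<^sup>T\<close>, whose off-diagonal entries these are. Equivalently, the reflection \<open>F\<inverse> Z F\<close> is the
  transpose of \<open>C\<inverse> Z C\<close>.
\<close>

lemma pfaffian_EQ_transport:
  assumes C: "C \<in> carrier_mat 2 2" "invertible_mat C" and F: "F \<in> carrier_mat 2 2" "invertible_mat F"
    and EQ: "pfaffian_cogate_under EQ [mat_inv C, mat_inv F]"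
  shows "C $$ (0,1) * F $$ (1,1) + C $$ (0,0) * F $$ (1,0) = 0"
    and "C $$ (1,1) * F $$ (0,1) + C $$ (1,0) * F $$ (0,0) = 0"
proof -
  let ?P = "mat_inv C" and ?Q = "mat_inv F"
  let ?c = "det2 (entries C)" and ?f = "det2 (entries F)"
  have z: "?P $$ (0,0) * ?Q $$ (0,1) + ?P $$ (1,0) * ?Q $$ (1,1) = 0"
    "?P $$ (0,1) * ?Q $$ (0,0) + ?P $$ (1,1) * ?Q $$ (1,0) = 0"
    using pfaffian_cogate_odd[OF EQ] by (simp_all add: act_cogate_EQ)
  have "?c * ?P $$ (0,0) * (?f * ?Q $$ (0,1)) + ?c * ?P $$ (1,0) * (?f * ?Q $$ (1,1)) =
      ?c * ?f * (?P $$ (0,0) * ?Q $$ (0,1) + ?P $$ (1,0) * ?Q $$ (1,1))"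
    "?c * ?P $$ (0,1) * (?f * ?Q $$ (0,0)) + ?c * ?P $$ (1,1) * (?f * ?Q $$ (1,0)) =
      ?c * ?f * (?P $$ (0,1) * ?Q $$ (0,0) + ?P $$ (1,1) * ?Q $$ (1,0))"
    by (simp_all add: algebra_simps)
  hence "C $$ (1,1) * (- F $$ (0,1)) + (- C $$ (1,0)) * F $$ (0,0) = 0"
    "(- C $$ (0,1)) * F $$ (1,1) + C $$ (0,0) * (- F $$ (1,0)) = 0"
    unfolding z mat_inv_entries(2-5)[OF C] mat_inv_entries(2-5)[OF F] by simp_all
  thus "C $$ (0,1) * F $$ (1,1) + C $$ (0,0) * F $$ (1,0) = 0"
    "C $$ (1,1) * F $$ (0,1) + C $$ (1,0) * F $$ (0,0) = 0"
    by (simp_all add: eq_neg_iff_add_eq_0 neg_eq_iff_add_eq_0)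
qed

text \<open>
  The reflection of \<open>f\<close> is the transpose of that of \<open>c\<close>, so it anticommutes with the bit flip as well
  as with \<open>Z\<close>. The conclusion says that its two off-diagonal entries are opposite, as for \<open>\<plusminus>Y\<close>.
\<close>

lemma column_products_eq:
  assumes c: "perm2 (hadamard c) = 0" "det2 c \<noteq> 0" and f: "perm2 f = 0" "det2 f \<noteq> 0"
    and t: "c 0 1 * f 1 1 + c 0 0 * f 1 0 = 0" "c 1 1 * f 0 1 + c 1 0 * f 0 0 = 0"
  shows "f 0 1 * f 1 1 = f 0 0 * f 1 0"
proof -
  note nz = entries_nonzero[OF f]
  have "c 0 0 \<noteq> 0" "c 1 0 \<noteq> 0" using c(2) t nz unfolding det2_def by auto
  moreover have e: "c 0 1 * c 1 1 = c 0 0 * c 1 0" using c(1) unfolding perm2_hadamard by simp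
  moreover have "c 0 1 * f 1 1 * (c 1 1 * f 0 1) = c 0 0 * f 1 0 * (c 1 0 * f 0 0)"
    using t by (simp add: add_eq_0_iff)
  hence "c 0 1 * c 1 1 * (f 0 1 * f 1 1) = c 0 0 * c 1 0 * (f 0 0 * f 1 0)" by (simp add: mult_ac)
  ultimately show ?thesis by simp
qed

theorem theorem8:
  shows "\<not> (\<exists>A B C D E F G H I J K L :: complex mat.
    (\<forall>M \<in> {A, B, C, D, E, F, G, H, I, J, K, L}. M \<in> carrier_mat 2 2 \<and> invertible_mat M) \<and>
    pfaffian_gate_under CNOT1 [A, B, C, D] \<and>
    pfaffian_gate_under CNOT2 [E, F, G, H] \<and>
    pfaffian_gate_under CNOT1 [I, J, K, L] \<and>
    pfaffian_cogate_under EQ [mat_inv D, mat_inv E] \<and>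
    pfaffian_cogate_under EQ [mat_inv C, mat_inv F] \<and>
    pfaffian_cogate_under EQ [mat_inv H, mat_inv I] \<and>
    pfaffian_cogate_under EQ [mat_inv G, mat_inv J])"
proof (intro notI, elim exE conjE)
  fix A B C D E F G H I J K L :: "complex mat"
  assume inv: "\<forall>M \<in> {A, B, C, D, E, F, G, H, I, J, K, L}. M \<in> carrier_mat 2 2 \<and> invertible_mat M"
    and g1: "pfaffian_gate_under CNOT1 [A, B, C, D]"
    and g2: "pfaffian_gate_under CNOT2 [E, F, G, H]"
    and g3: "pfaffian_gate_under CNOT1 [I, J, K, L]"
    and CF: "pfaffian_cogate_under EQ [mat_inv C, mat_inv F]"
    and GJ: "pfaffian_cogate_under EQ [mat_inv G, mat_inv J]"
  have det: "det2 (entries M) \<noteq> 0" "det2 (hadamard (entries M)) \<noteq> 0"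
    if "M \<in> {A, B, C, D, E, F, G, H, I, J, K, L}" for M
    using inv mat_inv_entries(1)[of M] that by (auto simp: det2_hadamard)
  have C: "perm2 (hadamard (entries C)) = 0"
    by (rule sign_tensor_perm2(3)[OF pfaffian_CNOT1_matchgate4[OF g1]]) (rule det; simp)+
  have J: "perm2 (hadamard (entries J)) = 0"
    by (rule sign_tensor_perm2(2)[OF pfaffian_CNOT1_matchgate4[OF g3]]) (rule det; simp)+
  have mg: "matchgate4 (sign_tensor (entries F) (hadamard (entries E)) (hadamard (entries H)) (entries G))"
    by (rule pfaffian_CNOT2_matchgate4[OF g2]) (rule det; simp)+
  have F: "perm2 (entries F) = 0" and G: "perm2 (entries G) = 0"
    by (rule sign_tensor_perm2(1,4)[OF mg]; (rule det; simp))+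
  have ratio: "F $$ (0,1) * F $$ (1,1) * (G $$ (0,1) * G $$ (1,1)) =
      - (F $$ (0,0) * F $$ (1,0) * (G $$ (0,0) * G $$ (1,0)))"
    by (rule sign_tensor_ratio[OF mg]) (rule det; simp)+
  have dC: "det2 (entries C) \<noteq> 0" and dF: "det2 (entries F) \<noteq> 0"
    and dG: "det2 (entries G) \<noteq> 0" and dJ: "det2 (entries J) \<noteq> 0" by (rule det; simp)+
  have "F $$ (0,1) * F $$ (1,1) = F $$ (0,0) * F $$ (1,0)"
    by (rule column_products_eq[OF C dC F dF]) (rule pfaffian_EQ_transport[OF _ _ _ _ CF]; use inv in simp)+
  \<comment> \<open>Here the target wire is the second end of the edge; the transport equations are symmetric in the two ends.\<close>
  moreover have "G $$ (0,1) * G $$ (1,1) = G $$ (0,0) * G $$ (1,0)"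
    using pfaffian_EQ_transport[OF _ _ _ _ GJ] inv
    by (intro column_products_eq[OF J dJ G dG]) (simp_all add: mult.commute)
  ultimately show False
    using ratio entries_nonzero[OF F dF] entries_nonzero[OF G dG] by simp
qed

end
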